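(* Let $N\in\mathbb{N}$, let $\rho=(\rho_1,\ldots,\rho_m)$ be a composition of $N$, let $r_i:=\sum_{k=1}^{i}\rho_k$ for $i\in\{1,\ldots,m-1\}$, and let $R:=\{r_1,\ldots,r_{m-1}\}\subseteq\{1,\ldots,N-1\}$. Then the pair $(\mathrm{stc},\ell)$ on $S_N^{R^c}$ is equidistributed with the pair $(\mathrm{des},\mathrm{maj})$ on $S_\rho$, that is, $$\sum_{w\in S_\rho}x^{\mathrm{des}(w)}q^{\mathrm{maj}(w)}=\sum_{w\in S_N^{R^c}}x^{\mathrm{stc}(w)}q^{\ell(w)}$$ as polynomials in $\mathbb{Z}[x,q]$.
   Context: Notation: $[n]=\{1,\ldots,n\}$. A composition $\rho=(\rho_1,\ldots,\rho_m)$ of $N$ is a finite sequence of positive integers with sum $N$. $S_\rho$ is the set of all permutations (rearrangements) $w=w_1\cdots w_N$ of the multiset $\{1^{\rho_1},\ldots,m^{\rho_m}\}$, in which the letter $i$ occurs $\rho_i$ times. For $w\in S_\rho$ (and likewise for $w$ in the symmetric group $S_N$, written in one-line notation $w_i=w(i)$), $\mathrm{Des}(w)=\{i\in[N-1] : w_i>w_{i+1}\}$, $\mathrm{des}(w)=|\mathrm{Des}(w)|$, $\mathrm{maj}(w)=\sum_{i\in \mathrm{Des}(w)}i$. For $R\subseteq[N-1]$, $S_N^{R^c}:=\{w\in S_N : \mathrm{Des}(w)\subseteq R\}$. For $\sigma\in S_n$, $\ell(\sigma)$ is the Coxeter length, which equals the inversion number $\mathrm{inv}(\sigma)=|\{(i,j)\in[n]\times[n]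 : i<j,\ \sigma(i)>\sigma(j)\}|$. The code of $\sigma\in S_n$ is the word $\mathrm{code}(\sigma)=c_1\cdots c_n$ with $c_i=|\{j : i<j\le n,\ \sigma(i)>\sigma(j)\}|$. For a word $w=w_1\cdots w_n$ of nonnegative integers with $w_i\le n-i$, $\mathrm{st}(w)$ is the largest $r\in[n]$ for which there exist indices $i_1<\cdots<i_r$ such that $w_{i_1}\cdots w_{i_r}>(r-1)(r-2)\cdots 1\,0$ componentwise and strictly, i.e. $w_{i_j}>r-j$ for all $j=1,\ldots,r$; $\mathrm{st}(w)=0$ if no such $r$ exists. Then $\mathrm{stc}(\sigma):=\mathrm{st}(\mathrm{code}(\sigma))$. (For example, $\sigma=452361$ has code $331110$ and $\mathrm{stc}(\sigma)=3$.) *)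

theory Defs
  imports "HOL-Combinatorics.Combinatorics" "HOL-Computational_Algebra.Polynomial"
begin

text \<open>
  Words are lists. The mathematical positions are \<open>1, \<dots>, N\<close>, so the letter \<open>w\<^sub>i\<close> is \<open>w ! (i - 1)\<close>.
  Permutations in \<open>S\<^sub>N\<close> are functions with \<open>\<sigma> permutes {1..N}\<close>.
\<close>

definition composition :: "nat \<Rightarrow> nat list \<Rightarrow> bool" where
  "composition N \<rho> \<longleftrightarrow> (\<forall>k\<in>set \<rho>. 0 < k) \<and> sum_list \<rho> = N"

definition content :: "nat list \<Rightarrow> nat multiset" where
  "content \<rho> = (\<Sum>i\<in>{1..length \<rho>}. replicate_mset (\<rho> ! (i - 1)) i)"

definition multiperms :: "nat list \<Rightarrow> nat list set" where
  "multiperms \<rho> = permutations_of_multiset (content \<rho>)"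

definition Des :: "nat list \<Rightarrow> nat set" where
  "Des w = {i \<in> {1..length w - 1}. w ! (i - 1) > w ! i}"

definition des :: "nat list \<Rightarrow> nat" where
  "des w = card (Des w)"

definition maj :: "nat list \<Rightarrow> nat" where
  "maj w = \<Sum> (Des w)"

definition one_line :: "nat \<Rightarrow> (nat \<Rightarrow> nat) \<Rightarrow> nat list" where
  "one_line N \<sigma> = map \<sigma> [1..<Suc N]"

text \<open>The set written \<open>S\<close> with subscript \<open>N\<close> and superscript \<open>R\<^sup>c\<close>: descents are allowed only
  in \<open>R\<close>, not in its complement.\<close>

definition perms_Des_in :: "nat \<Rightarrow> nat set \<Rightarrow> (nat \<Rightarrow> nat) set" where
  "perms_Des_in N R = {\<sigma>. \<sigma> permutes {1..N} \<and> Des (one_line N \<sigma>) \<subseteq> R}"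

text \<open>Coxeter length of \<open>\<sigma> \<in> S\<^sub>n\<close> with respect to the simple transpositions \<open>(i, i + 1)\<close>, \<open>1 \<le> i < n\<close>.\<close>

definition coxeter_length :: "nat \<Rightarrow> (nat \<Rightarrow> nat) \<Rightarrow> nat" where
  "coxeter_length n \<sigma> =
     (LEAST k. \<exists>is. length is = k \<and> set is \<subseteq> {1..<n} \<and>
        \<sigma> = foldr (\<lambda>i \<tau>. transpose i (Suc i) \<circ> \<tau>) is id)"

definition code :: "nat \<Rightarrow> (nat \<Rightarrow> nat) \<Rightarrow> nat list" where
  "code n \<sigma> = map (\<lambda>i. card {j. i < j \<and> j \<le> n \<and> \<sigma> i > \<sigma> j}) [1..<Suc n]"

text \<open>The function \<open>p\<close> gives the indices \<open>p 1 < \<dots> < p r\<close>; the inserted \<open>0\<close> is the value when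
  no \<open>r \<ge> 1\<close> qualifies. Since \<open>j \<le> r\<close>, the natural number subtraction \<open>r - j\<close> does not truncate.\<close>

definition st :: "nat list \<Rightarrow> nat" where
  "st w = Max (insert 0 {r \<in> {1..length w}.
     \<exists>p. strict_mono_on {1..r} p \<and> p ` {1..r} \<subseteq> {1..length w} \<and>
         (\<forall>j\<in>{1..r}. w ! (p j - 1) > r - j)})"

definition stc :: "nat \<Rightarrow> (nat \<Rightarrow> nat) \<Rightarrow> nat" where
  "stc n \<sigma> = st (code n \<sigma>)"

text \<open>The ring \<open>\<int>[x, q]\<close> is represented as \<open>\<int>[q][x]\<close>.\<close>

definition var_x :: "int poly poly" where
  "var_x = [:0, 1:]"

definition var_q :: "int poly poly" where
  "var_q = [:[:0, 1:]:]"

end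

theory Submission
  imports Defs
begin

text \<open>
  The statistic \<open>st\<close> of a word of nonnegative integers can be computed greedily from right to left:
  a letter \<open>c\<close> raises the value \<open>s\<close> reached so far by one iff \<open>c > s\<close> (\<open>st_eq_foldr_greedy_step\<close>).
  The code is a bijection from \<open>S\<^sub>N\<close> to the words bounded by the staircase \<open>N - 1, \<dots>, 1, 0\<close>; it
  preserves the descent set, and its letters sum to the length. So the right-hand side is a sum over
  those bounded words which increase weakly inside each block of length \<open>\<rho>\<^sub>i\<close>. Weak increase
  reduces the bounds inside a block to a single one, namely the number \<open>n\<close> of letters to the right
  of the block: a block of length \<open>r\<close> is an arbitrary partition in an \<open>r \<times> n\<close> box.

  On the left-hand side, a word of content \<open>\<rho>\<close> arises from a word \<open>b\<close> in the letters
  \<open>2, \<dots>, m\<close>, of length \<open>n\<close> say, by inserting \<open>\<rho>\<^sub>1\<close> letters \<open>1\<close>. The key fact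
  (\<open>sum_insertions\<close>) is that the distribution of \<open>(des, maj)\<close> over these insertions is that of
  \<open>(s, M)\<close> over the partitions in a \<open>\<rho>\<^sub>1 \<times> n\<close> box, where \<open>M\<close> is \<open>maj b\<close> plus the sum of the
  parts and \<open>s\<close> is reached greedily from \<open>des b\<close>. Prefixing a block to a bounded word \<open>v\<close> has
  exactly the same effect, with \<open>(st v, \<Sum> v)\<close> in place of \<open>(des b, maj b)\<close>. Induction on the number
  of parts of \<open>\<rho>\<close> therefore shows that the two pairs are equidistributed.

  The key fact follows by comparing two recursions. A partition in a box either has a largest possible
  part or lies in a smaller box; it either has a part \<open>0\<close> or all its parts can be lowered by one. An
  insertion either ends in an inserted letter or in the last letter of \<open>b\<close>, and deleting this last
  letter leads to a shorter word. The classes of insertions correspond to the classes of partitions.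

  Equidistribution of two pairs of statistics is expressed throughout as equality of the sums of
  \<open>f s M\<close> for every function \<open>f\<close> into a commutative monoid. This form can be applied to the
  contribution of a whole block, which is itself a function of \<open>s\<close> and \<open>M\<close>.
\<close>

section \<open>Greedy evaluation of the statistic st\<close>

definition greedy_step :: "nat \<Rightarrow> nat \<Rightarrow> nat" where
  "greedy_step c s = (if s < c then Suc s else s)"

text \<open>
  The condition in the definition of \<open>st\<close>: \<open>w\<close> has a subsequence of length \<open>r\<close> that lies
  strictly above \<open>r - 1, \<dots>, 1, 0\<close>.
\<close>

definition staircase_subseq :: "nat list \<Rightarrow> nat \<Rightarrow> bool" where
  "staircase_subseq w r \<longleftrightarrow> (\<exists>p. strict_mono_on {1..r} p \<and> p ` {1..r} \<subseteq> {1..length w} \<and>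
         (\<forall>j\<in>{1..r}. w ! (p j - 1) > r - j))"

lemma staircase_subseq_0: "staircase_subseq w 0"
  by (auto simp: staircase_subseq_def)

lemma staircase_subseq_Cons:
  assumes "staircase_subseq w r"
  shows "staircase_subseq (c # w) r"
proof -
  obtain p where p: "strict_mono_on {1..r} p" "p ` {1..r} \<subseteq> {1..length w}"
    "\<forall>j\<in>{1..r}. w ! (p j - 1) > r - j"
    using assms by (auto simp: staircase_subseq_def)
  have "strict_mono_on {1..r} (Suc \<circ> p)" using p(1) by (auto simp: strict_mono_on_def)
  moreover have "(Suc \<circ> p) ` {1..r} \<subseteq> {1..length (c # w)}" using p(2) by auto
  moreover have "(c # w) ! ((Suc \<circ> p) j - 1) > r - j" if "j \<in> {1..r}" for j
  proof -
    have "p j \<in> {1..length w}" using p(2) that by blast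
    then have "(c # w) ! p j = w ! (p j - 1)" by (cases "p j") auto
    then show ?thesis using p(3) that by simp
  qed
  ultimately show ?thesis unfolding staircase_subseq_def by blast
qed

text \<open>
  A subsequence that starts with the new letter \<open>c\<close> has its remaining letters compared with the same
  bounds \<open>r - 1, \<dots>, 0\<close> as before, since the bounds are counted from the right; only \<open>c > r\<close> is new.
\<close>

lemma staircase_subseq_extend:
  assumes "staircase_subseq w r" "r < c"
  shows "staircase_subseq (c # w) (Suc r)"
proof -
  obtain p where p: "strict_mono_on {1..r} p" "p ` {1..r} \<subseteq> {1..length w}"
    "\<forall>j\<in>{1..r}. w ! (p j - 1) > r - j"
    using assms by (auto simp: staircase_subseq_def)
  \<comment> \<open>The new letter comes first, and the old positions shift by one.\<close>
  define q where "q j = (if j = 1 then 1 else Suc (p (j - 1)))" for j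
  have range: "p j \<in> {1..length w}" if "j \<in> {1..r}" for j using p(2) that by blast
  have "strict_mono_on {1..Suc r} q"
  proof (rule strict_mono_onI)
    fix i j assume ij: "i \<in> {1..Suc r}" "j \<in> {1..Suc r}" "i < j"
    show "q i < q j"
    proof (cases "i = 1")
      case True
      then have "j - 1 \<in> {1..r}" using ij by auto
      then show ?thesis using range[of "j - 1"] True ij by (auto simp: q_def)
    next
      case False
      then show ?thesis
        using strict_mono_onD[OF p(1), of "i - 1" "j - 1"] ij by (auto simp: q_def)
    qed
  qed
  moreover have "q ` {1..Suc r} \<subseteq> {1..length (c # w)}"
  proof
    fix x assume "x \<in> q ` {1..Suc r}"
    then obtain j where "j \<in> {1..Suc r}" "x = q j" by blast
    then show "x \<in> {1..length (c # w)}"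
      using range[of "j - 1"] by (cases "j = 1") (fastforce simp: q_def)+
  qed
  moreover have "(c # w) ! (q j - 1) > Suc r - j" if j: "j \<in> {1..Suc r}" for j
  proof (cases "j = 1")
    case True
    then show ?thesis using assms(2) by (simp add: q_def)
  next
    case False
    then have j1: "j - 1 \<in> {1..r}" using j by auto
    then have "(c # w) ! p (j - 1) = w ! (p (j - 1) - 1)"
      using range[OF j1] by (cases "p (j - 1)") auto
    moreover have "w ! (p (j - 1) - 1) > r - (j - 1)" using p(3) j1 by blast
    ultimately show ?thesis using False j by (simp add: q_def)
  qed
  ultimately show ?thesis unfolding staircase_subseq_def by blast
qed

text \<open>
  Converse of the last two lemmas: the subsequence either avoids the first letter, or begins with it
  and leaves a subsequence shorter by one.
\<close>

lemma staircase_subseq_ConsD: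
  assumes "staircase_subseq (c # w) r"
  shows "staircase_subseq w r \<or> (\<exists>r'. r = Suc r' \<and> r' < c \<and> staircase_subseq w r')"
proof (cases r)
  case 0
  then show ?thesis by (simp add: staircase_subseq_0)
next
  case (Suc r')
  obtain p where p: "strict_mono_on {1..r} p" "p ` {1..r} \<subseteq> {1..length (c # w)}"
    "\<forall>j\<in>{1..r}. (c # w) ! (p j - 1) > r - j"
    using assms by (auto simp: staircase_subseq_def)
  have range: "p j \<in> {1..Suc (length w)}" if "j \<in> {1..r}" for j using p(2) that by force
  have gt: "p 1 < p j" if "j \<in> {2..r}" for j
    using strict_mono_onD[OF p(1), of 1 j] that by auto
  have nth: "(c # w) ! (p j - 1) = w ! (p j - 1 - 1)" if "2 \<le> p j" for j
    using that by (cases "p j - 1") auto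
  show ?thesis
  proof (cases "p 1 = 1")
    case True
    let ?q = "\<lambda>j. p (Suc j) - 1"
    have "r' < c" using p(3)[rule_format, of 1] True Suc by simp
    moreover have "staircase_subseq w r'"
      unfolding staircase_subseq_def
    proof (intro exI[of _ ?q] conjI)
      show "strict_mono_on {1..r'} ?q"
      proof (rule strict_mono_onI)
        fix i j assume ij: "i \<in> {1..r'}" "j \<in> {1..r'}" "i < j"
        then have "p (Suc i) < p (Suc j)"
          using strict_mono_onD[OF p(1), of "Suc i" "Suc j"] Suc by auto
        then show "?q i < ?q j" using gt[of "Suc i"] ij Suc by auto
      qed
      show "?q ` {1..r'} \<subseteq> {1..length w}"
      proof
        fix x assume "x \<in> ?q ` {1..r'}"
        then obtain j where j: "j \<in> {1..r'}" "x = p (Suc j) - 1" by blast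
        then show "x \<in> {1..length w}" using gt[of "Suc j"] range[of "Suc j"] True Suc by auto
      qed
      show "\<forall>j\<in>{1..r'}. r' - j < w ! (?q j - 1)"
      proof
        fix j assume j: "j \<in> {1..r'}"
        then show "r' - j < w ! (?q j - 1)"
          using gt[of "Suc j"] p(3)[rule_format, of "Suc j"] nth[of "Suc j"] True Suc by auto
      qed
    qed
    ultimately show ?thesis using Suc by blast
  next
    case False
    have ge2: "2 \<le> p j" if "j \<in> {1..r}" for j
      using that range[of 1] False gt[of j] by (cases "j = 1") auto
    have "staircase_subseq w r"
      unfolding staircase_subseq_def
    proof (intro exI[of _ "\<lambda>j. p j - 1"] conjI)
      show "strict_mono_on {1..r} (\<lambda>j. p j - 1)"
      proof (rule strict_mono_onI)
        fix i j assume ij: "i \<in> {1..r}" "j \<in> {1..r}" "i < j"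
        then show "p i - 1 < p j - 1"
          using strict_mono_onD[OF p(1), of i j] ge2[of i] by auto
      qed
      show "(\<lambda>j. p j - 1) ` {1..r} \<subseteq> {1..length w}"
      proof
        fix x assume "x \<in> (\<lambda>j. p j - 1) ` {1..r}"
        then obtain j where "j \<in> {1..r}" "x = p j - 1" by blast
        then show "x \<in> {1..length w}" using ge2[of j] range[of j] by auto
      qed
      show "\<forall>j\<in>{1..r}. r - j < w ! (p j - 1 - 1)"
      proof
        fix j assume j: "j \<in> {1..r}"
        then show "r - j < w ! (p j - 1 - 1)"
          using p(3)[rule_format, OF j] nth[OF ge2[OF j]] by simp
      qed
    qed
    then show ?thesis by blast
  qed
qed

text \<open>
  A subsequence that begins with \<open>c\<close> has length at most \<open>c\<close>. So if \<open>c\<close> does not exceed the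
  greedy value of \<open>w\<close>, a subsequence that uses \<open>c\<close> cannot be longer than this value.
\<close>

lemma staircase_subseq_le: "staircase_subseq w r \<Longrightarrow> r \<le> foldr greedy_step w 0"
proof (induction w arbitrary: r)
  case Nil
  then have "{1..r} = {}" by (force simp: staircase_subseq_def)
  then show ?case by simp
next
  case (Cons c w)
  show ?case
    using staircase_subseq_ConsD[OF Cons.prems] Cons.IH by (force simp: greedy_step_def)
qed

lemma staircase_subseq_greedy: "staircase_subseq w (foldr greedy_step w 0)"
  by (induction w)
    (auto simp: greedy_step_def staircase_subseq_0 staircase_subseq_Cons staircase_subseq_extend)

lemma st_eq_foldr_greedy_step: "st w = foldr greedy_step w 0"
proof -
  have le: "foldr greedy_step w 0 \<le> length w" by (induction w) (auto simp: greedy_step_def)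
  have "st w = Max (insert 0 {r \<in> {1..length w}. staircase_subseq w r})"
    by (simp add: st_def staircase_subseq_def)
  also have "\<dots> = foldr greedy_step w 0"
  proof (rule Max_eqI)
    show "foldr greedy_step w 0 \<in> insert 0 {r \<in> {1..length w}. staircase_subseq w r}"
      using le staircase_subseq_greedy[of w] by (cases "foldr greedy_step w 0 = 0") auto
  qed (auto simp: staircase_subseq_le)
  finally show ?thesis .
qed

section \<open>Partitions in a box\<close>

text \<open>
  Partitions with \<open>r\<close> parts (zero allowed), all at most \<open>n\<close>, written in increasing order because
  that is how they occur in a code.
\<close>

definition box :: "nat \<Rightarrow> nat \<Rightarrow> nat list set" where
  "box n r = {c. length c = r \<and> sorted c \<and> set c \<subseteq> {..n}}"

text \<open>
  The parts are processed from the largest to the smallest, starting from the greedy value \<open>s\<close>;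
  \<open>M\<close> accumulates their sum.
\<close>

definition box_sum :: "(nat \<Rightarrow> nat \<Rightarrow> 'a::comm_monoid_add) \<Rightarrow> nat \<Rightarrow> nat \<Rightarrow> nat \<Rightarrow> nat \<Rightarrow> 'a" where
  "box_sum f n s M r = (\<Sum>c\<in>box n r. f (foldr greedy_step c s) (M + sum_list c))"

lemma finite_box: "finite (box n r)"
  by (rule finite_subset[OF _ finite_lists_length_eq[of "{..n}" r]]) (auto simp: box_def)

lemma box_sum_no_parts: "box_sum f n s M 0 = f s M"
proof -
  have "box n 0 = {[]}" by (auto simp: box_def)
  then show ?thesis by (simp add: box_sum_def)
qed

lemma box_sum_zero_parts: "box_sum f 0 s M r = f s M"
proof -
  have "box 0 r = {replicate r 0}"
    by (auto simp: box_def intro!: replicate_eqI)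
  moreover have "foldr greedy_step (replicate r 0) s = s"
    by (induction r) (auto simp: greedy_step_def)
  ultimately show ?thesis by (simp add: box_sum_def sum_list_replicate)
qed

lemma box_split_largest:
  "box (Suc n) (Suc r) = box n (Suc r) \<union> (\<lambda>c. c @ [Suc n]) ` box (Suc n) r"
proof (intro set_eqI iffI)
  fix c assume "c \<in> box (Suc n) (Suc r)"
  then have c: "length c = Suc r" "sorted c" "set c \<subseteq> {..Suc n}" by (auto simp: box_def)
  then obtain c' a where ca: "c = c' @ [a]" by (cases c rule: rev_cases) auto
  show "c \<in> box n (Suc r) \<union> (\<lambda>c. c @ [Suc n]) ` box (Suc n) r"
  proof (cases "a = Suc n")
    case True
    then show ?thesis using c ca by (auto simp: box_def sorted_append)
  next
    case False
    then have "a \<le> n" using c ca by auto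
    then have "c \<in> box n (Suc r)"
      using c ca by (fastforce simp: box_def sorted_append)
    then show ?thesis by simp
  qed
qed (fastforce simp: box_def sorted_append)

lemma box_split_smallest:
  "box (Suc n) (Suc r) = (#) 0 ` box (Suc n) r \<union> map Suc ` box n (Suc r)"
proof (intro set_eqI iffI)
  fix c assume "c \<in> box (Suc n) (Suc r)"
  then have c: "length c = Suc r" "sorted c" "set c \<subseteq> {..Suc n}" by (auto simp: box_def)
  then obtain a c' where ca: "c = a # c'" by (cases c) auto
  show "c \<in> (#) 0 ` box (Suc n) r \<union> map Suc ` box n (Suc r)"
  proof (cases "a = 0")
    case True
    then show ?thesis using c ca by (auto simp: box_def)
  next
    case False
    then have pos: "\<forall>x\<in>set c. 0 < x" using c ca by fastforce
    have "c = map Suc (map (\<lambda>x. x - 1) c)"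
      using pos by (auto simp: map_idI)
    moreover have "map (\<lambda>x. x - 1) c \<in> box n (Suc r)"
      using c by (auto simp: box_def sorted_iff_nth_mono intro: diff_le_mono)
    ultimately show ?thesis by blast
  qed
qed (auto simp: box_def sorted_map)

lemma foldr_greedy_step_map_Suc: "foldr greedy_step (map Suc c) (Suc s) = Suc (foldr greedy_step c s)"
  by (induction c) (auto simp: greedy_step_def)

lemma sum_list_map_Suc: "sum_list (map Suc c) = sum_list c + length c"
  by (induction c) auto

text \<open>
  The largest part is processed first. If it is \<open>Suc n > s\<close>, it raises the greedy value, and the
  remaining parts range over a box of the same width.
\<close>

lemma box_sum_split_largest:
  assumes "s \<le> n"
  shows "box_sum f (Suc n) s M (Suc r) =
    box_sum f n s M (Suc r) + box_sum f (Suc n) (Suc s) (M + Suc n) r"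
proof -
  have disj: "box n (Suc r) \<inter> (\<lambda>c. c @ [Suc n]) ` box (Suc n) r = {}"
    by (auto simp: box_def)
  have "inj_on (\<lambda>c. c @ [Suc n]) (box (Suc n) r)" by (auto intro: inj_onI)
  then show ?thesis
    using assms
    by (simp add: box_sum_def box_split_largest sum.union_disjoint[OF _ _ disj] finite_box
        sum.reindex greedy_step_def add_ac)
qed

text \<open>
  A part \<open>0\<close> never changes the greedy value. If no part is \<open>0\<close>, lowering all \<open>Suc r\<close> parts
  together with the starting value by one leaves all greedy comparisons as they are, and the sum drops
  by \<open>Suc r\<close>.
\<close>

lemma box_sum_split_smallest:
  "box_sum f (Suc n) (Suc s) M (Suc r) =
    box_sum f (Suc n) (Suc s) M r + box_sum (\<lambda>s. f (Suc s)) n s (M + Suc r) (Suc r)"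
proof -
  have disj: "(#) 0 ` box (Suc n) r \<inter> map Suc ` box n (Suc r) = {}"
    by (auto simp: box_def)
  have "sum_list (map Suc c) = sum_list c + Suc r" if "c \<in> box n (Suc r)" for c
    using that by (simp add: sum_list_map_Suc box_def)
  then have "(\<Sum>c\<in>map Suc ` box n (Suc r). f (foldr greedy_step c (Suc s)) (M + sum_list c)) =
      box_sum (\<lambda>s. f (Suc s)) n s (M + Suc r) (Suc r)"
    unfolding box_sum_def
    by (subst sum.reindex) (auto simp: foldr_greedy_step_map_Suc add_ac intro!: sum.cong inj_onI)
  moreover have "(\<Sum>c\<in>(#) 0 ` box (Suc n) r. f (foldr greedy_step c (Suc s)) (M + sum_list c)) =
      box_sum f (Suc n) (Suc s) M r"
    unfolding box_sum_def by (subst sum.reindex) (auto simp: greedy_step_def)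
  ultimately show ?thesis
    by (simp add: box_sum_def[of f "Suc n" "Suc s" M "Suc r"] box_split_smallest
        sum.union_disjoint[OF _ _ disj] finite_box)
qed

section \<open>Inserting copies of a smallest letter\<close>

lemma Des_snoc:
  "Des (w @ [c]) = Des w \<union> (if w \<noteq> [] \<and> c < last w then {length w} else {})"
  by (cases w rule: rev_cases) (auto simp: Des_def nth_append split: if_splits)

lemma finite_Des: "finite (Des w)"
  by (simp add: Des_def)

lemma des_snoc: "des (w @ [c]) = des w + (if w \<noteq> [] \<and> c < last w then 1 else 0)"
  and maj_snoc: "maj (w @ [c]) = maj w + (if w \<noteq> [] \<and> c < last w then length w else 0)"
proof -
  have "length w \<notin> Des w" by (auto simp: Des_def)
  then show "des (w @ [c]) = des w + (if w \<noteq> [] \<and> c < last w then 1 else 0)"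
    "maj (w @ [c]) = maj w + (if w \<noteq> [] \<and> c < last w then length w else 0)"
    by (auto simp: des_def maj_def Des_snoc finite_Des)
qed

lemma des_le_length: "des w \<le> length w - 1"
  unfolding des_def by (rule order_trans[OF card_mono[of "{1..length w - 1}"]]) (auto simp: Des_def)

text \<open>
  The words obtained from \<open>b\<close> by inserting \<open>r\<close> letters \<open>k\<close>; this description is meant for \<open>b\<close>
  without the letter \<open>k\<close>.
\<close>

definition insertions :: "nat \<Rightarrow> nat list \<Rightarrow> nat \<Rightarrow> nat list set" where
  "insertions k b r = {w. filter (\<lambda>a. a \<noteq> k) w = b \<and> count_list w k = r}"

lemma length_insertions:
  assumes "w \<in> insertions k b r"
  shows "length w = length b + r"
proof -
  have "length w = length (filter (\<lambda>a. a \<noteq> k) w) + count_list w k"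
    by (induction w) auto
  then show ?thesis using assms by (simp add: insertions_def)
qed

lemma finite_insertions: "finite (insertions k b r)"
proof (rule finite_subset[OF _ finite_lists_length_eq[of "insert k (set b)" "length b + r"]])
  show "insertions k b r \<subseteq> {w. set w \<subseteq> insert k (set b) \<and> length w = length b + r}"
    by (auto simp: length_insertions) (auto simp: insertions_def)
qed simp

lemma insertions_snoc_other:
  "c \<noteq> k \<Longrightarrow> {w \<in> insertions k (b @ [c]) r. last w \<noteq> k} = (\<lambda>w. w @ [c]) ` insertions k b r"
proof (intro set_eqI iffI)
  fix w assume "c \<noteq> k" "w \<in> {w \<in> insertions k (b @ [c]) r. last w \<noteq> k}"
  then show "w \<in> (\<lambda>w. w @ [c]) ` insertions k b r"
    by (cases w rule: rev_cases) (auto simp: insertions_def)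
qed (auto simp: insertions_def)

lemma insertions_snoc_same:
  "{w \<in> insertions k b (Suc r). last w = k} = (\<lambda>w. w @ [k]) ` insertions k b r"
proof (intro set_eqI iffI)
  fix w assume "w \<in> {w \<in> insertions k b (Suc r). last w = k}"
  then show "w \<in> (\<lambda>w. w @ [k]) ` insertions k b r"
    by (cases w rule: rev_cases) (auto simp: insertions_def)
qed (auto simp: insertions_def)

lemma insertions_Nil: "insertions k [] r = {replicate r k}"
proof -
  have "w = replicate (count_list w k) k" if "\<forall>a\<in>set w. a = k" for w
    using that by (induction w) auto
  moreover have "count_list (replicate r k) k = r"
    by (induction r) auto
  ultimately show ?thesis by (auto simp: insertions_def filter_empty_conv)
qed

lemma des_replicate: "des (replicate r k) = 0" and maj_replicate: "maj (replicate r k) = 0"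
  by (auto simp: des_def maj_def Des_def)

text \<open>
  The sum over all insertions is split by the last letter, because this letter decides whether an
  appended letter creates a descent. The names fit the case of interest, in which all letters of \<open>b\<close>
  exceed \<open>k\<close>.
\<close>

definition sum_ending_above :: "(nat \<Rightarrow> nat \<Rightarrow> 'a::comm_monoid_add) \<Rightarrow> nat \<Rightarrow> nat list \<Rightarrow> nat \<Rightarrow> 'a" where
  "sum_ending_above f k b r = (\<Sum>w\<in>{w \<in> insertions k b r. last w \<noteq> k}. f (des w) (maj w))"

definition sum_ending_in :: "(nat \<Rightarrow> nat \<Rightarrow> 'a::comm_monoid_add) \<Rightarrow> nat \<Rightarrow> nat list \<Rightarrow> nat \<Rightarrow> 'a" where
  "sum_ending_in f k b r = (\<Sum>w\<in>{w \<in> insertions k b r. last w = k}. f (des w) (maj w))"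

text \<open>
  The summand may depend on the class of the word, so that the effect of an appended letter can be
  treated in both classes at once.
\<close>

lemma insertions_sum_split:
  "(\<Sum>w\<in>insertions k b r. f (last w = k) (des w) (maj w)) =
    sum_ending_in (f True) k b r + sum_ending_above (f False) k b r"
proof -
  have "(\<Sum>w\<in>insertions k b r. f (last w = k) (des w) (maj w)) =
     (\<Sum>w\<in>{w \<in> insertions k b r. last w = k} \<union> {w \<in> insertions k b r. last w \<noteq> k}.
        f (last w = k) (des w) (maj w))"
    by (rule sum.cong) auto
  also have "\<dots> = sum_ending_in (f True) k b r + sum_ending_above (f False) k b r"
    unfolding sum_ending_in_def sum_ending_above_def
    by (subst sum.union_disjoint) (auto simp: finite_insertions intro!: arg_cong2[of _ _ _ _ "(+)"])
  finally show ?thesis .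
qed

lemma insertions_nonempty: "w \<in> insertions k b r \<Longrightarrow> b \<noteq> [] \<Longrightarrow> w \<noteq> []"
  by (auto simp: insertions_def)

lemma last_insertions:
  assumes "w \<in> insertions k b r" "last w \<noteq> k" "b \<noteq> []"
  shows "last w = last b"
  using assms by (cases w rule: rev_cases) (auto simp: insertions_def)

lemma sum_ending_in_0: "b \<noteq> [] \<Longrightarrow> sum_ending_in f k b 0 = 0"
proof -
  assume "b \<noteq> []"
  have "{w \<in> insertions k b 0. last w = k} = {}"
  proof -
    have False if "w \<in> insertions k b 0" "last w = k" for w
      using that insertions_nonempty[OF that(1) \<open>b \<noteq> []\<close>]
      by (auto simp: insertions_def count_list_0_iff)
    then show ?thesis by auto
  qed
  then show ?thesis unfolding sum_ending_in_def by (simp only: sum.empty)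
qed

text \<open>
  Delete the final \<open>k\<close>. It follows another \<open>k\<close>, or it follows a larger letter and then creates a
  descent at position \<open>length b + r\<close>, the length of the remaining word.
\<close>

lemma sum_ending_in_Suc:
  assumes "b \<noteq> []" "\<forall>a\<in>set b. k < a"
  shows "sum_ending_in f k b (Suc r) =
    sum_ending_in f k b r + sum_ending_above (\<lambda>s M. f (Suc s) (M + length b + r)) k b r"
proof -
  have "sum_ending_in f k b (Suc r) = (\<Sum>w\<in>insertions k b r. f (des (w @ [k])) (maj (w @ [k])))"
    unfolding sum_ending_in_def insertions_snoc_same by (subst sum.reindex) (auto intro: inj_onI)
  also have "\<dots> = (\<Sum>w\<in>insertions k b r. (if last w = k then f (des w) (maj w)
      else f (Suc (des w)) (maj w + length b + r)))"
  proof (rule sum.cong[OF refl], goal_cases)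
    case (1 w)
    have "k < last w" if "last w \<noteq> k"
      using last_insertions[OF 1 that assms(1)] assms by simp
    then show ?case
      using insertions_nonempty[OF 1 assms(1)] length_insertions[OF 1]
      by (auto simp: des_snoc maj_snoc add_ac)
  qed
  also have "\<dots> = sum_ending_in f k b r + sum_ending_above (\<lambda>s M. f (Suc s) (M + length b + r)) k b r"
    using insertions_sum_split[of "\<lambda>p s M. if p then f s M else f (Suc s) (M + length b + r)"]
    by simp
  finally show ?thesis .
qed

text \<open>
  Delete the final \<open>c\<close>. After a letter \<open>k < c\<close> it creates no descent; otherwise it follows the
  last letter of \<open>b\<close>, and a descent there has position \<open>length b + r\<close>.
\<close>

lemma sum_ending_above_snoc:
  assumes "b \<noteq> []" "k < c"
  shows "sum_ending_above f k (b @ [c]) r =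
    sum_ending_in f k b r +
    sum_ending_above (\<lambda>s M. if c < last b then f (Suc s) (M + length b + r) else f s M) k b r"
proof -
  have "sum_ending_above f k (b @ [c]) r = (\<Sum>w\<in>insertions k b r. f (des (w @ [c])) (maj (w @ [c])))"
    using assms unfolding sum_ending_above_def
    by (simp only: insertions_snoc_other less_imp_neq[OF assms(2), symmetric] not_False_eq_True)
      (subst sum.reindex, auto intro: inj_onI)
  also have "\<dots> = (\<Sum>w\<in>insertions k b r. (if last w = k then f (des w) (maj w)
      else if c < last b then f (Suc (des w)) (maj w + length b + r) else f (des w) (maj w)))"
    using assms
    by (intro sum.cong refl)
      (auto simp: des_snoc maj_snoc length_insertions insertions_nonempty last_insertions add_ac)
  also have "\<dots> = sum_ending_in f k b r +
    sum_ending_above (\<lambda>s M. if c < last b then f (Suc s) (M + length b + r) else f s M) k b r"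
    using insertions_sum_split[of "\<lambda>p s M. if p then f s M else
      if c < last b then f (Suc s) (M + length b + r) else f s M"]
    by simp
  finally show ?thesis .
qed

text \<open>
  The insertions that end in \<open>k\<close> correspond to the partitions with a part equal to
  \<open>n = length b\<close>: this part is processed first, raises \<open>des b\<close> by one and contributes \<open>n\<close> to
  the sum. The induction on \<open>r\<close> matches the recursion of \<open>sum_ending_in_Suc\<close> with the split of a
  box by its smallest part.
\<close>

lemma sum_ending_in_eq_if_above:
  fixes f :: "nat \<Rightarrow> nat \<Rightarrow> 'a::comm_monoid_add"
  assumes "b \<noteq> []" "\<forall>a\<in>set b. k < a"
    and upper: "\<And>(f :: nat \<Rightarrow> nat \<Rightarrow> 'a) r. sum_ending_above f k b r = box_sum f (length b - 1) (des b) (maj b) r"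
  shows "sum_ending_in f k b (Suc r) = box_sum f (length b) (Suc (des b)) (maj b + length b) r"
proof (induction r)
  case 0
  then show ?case using assms
    by (simp add: sum_ending_in_Suc sum_ending_in_0 upper box_sum_no_parts)
next
  case (Suc r)
  obtain n where n: "length b = Suc n" using assms by (cases b) auto
  have shift: "box_sum (\<lambda>s M. f (Suc s) (M + Suc n + Suc r)) n (des b) (maj b) (Suc r) =
    box_sum (\<lambda>s. f (Suc s)) n (des b) (maj b + Suc n + Suc r) (Suc r)"
    unfolding box_sum_def by (intro sum.cong) (auto simp: add_ac)
  have "sum_ending_in f k b (Suc (Suc r)) = box_sum f (Suc n) (Suc (des b)) (maj b + Suc n) r +
    box_sum (\<lambda>s. f (Suc s)) n (des b) (maj b + Suc n + Suc r) (Suc r)"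
    unfolding sum_ending_in_Suc[OF assms(1,2), of f "Suc r"] upper Suc.IH
    unfolding n shift[symmetric] by simp
  also have "\<dots> = box_sum f (Suc n) (Suc (des b)) (maj b + Suc n) (Suc r)"
    by (rule box_sum_split_smallest[symmetric])
  finally show ?case by (simp add: n)
qed

text \<open>
  Insertions ending above \<open>k\<close> correspond to the partitions with parts less than \<open>length b\<close>, those
  ending in \<open>k\<close> to the remaining ones; together they fill the box of width \<open>length b\<close>.
\<close>

lemma box_sum_in_above:
  fixes f :: "nat \<Rightarrow> nat \<Rightarrow> 'a::comm_monoid_add"
  assumes "b \<noteq> []" "\<forall>a\<in>set b. k < a"
    and upper: "\<And>(f :: nat \<Rightarrow> nat \<Rightarrow> 'a) r. sum_ending_above f k b r = box_sum f (length b - 1) (des b) (maj b) r"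
  shows "sum_ending_in f k b r + sum_ending_above f k b r = box_sum f (length b) (des b) (maj b) r"
proof (cases r)
  case 0
  then show ?thesis using assms by (simp add: sum_ending_in_0 box_sum_no_parts)
next
  case (Suc r')
  obtain n where n: "length b = Suc n" using assms by (cases b) auto
  \<comment> \<open>Hence a part \<open>Suc n\<close> exceeds the starting value of the greedy procedure.\<close>
  have "des b \<le> n" using des_le_length[of b] n by simp
  then show ?thesis
    using sum_ending_in_eq_if_above[OF assms] upper box_sum_split_largest[of "des b" n f "maj b" r']
    by (simp add: Suc n add_ac)
qed

text \<open>
  Induction on \<open>b\<close>. If the last letter \<open>c\<close> creates no descent in \<open>b @ [c]\<close>, it creates none in an
  insertion either, and the claim is the full box for \<open>b\<close>. If it does, then in an insertion it
  creates one exactly if no \<open>k\<close> separates it from \<open>b\<close>; these insertions correspond to the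
  partitions without a part \<open>0\<close>, the others to the partitions with a part \<open>0\<close>.
\<close>

lemma sum_ending_above_eq:
  assumes "b \<noteq> []" "\<forall>a\<in>set b. k < a"
  shows "sum_ending_above f k b r = box_sum f (length b - 1) (des b) (maj b) r"
  using assms
proof (induction b arbitrary: f r rule: rev_induct)
  case Nil
  then show ?case by simp
next
  case (snoc c b)
  show ?case
  proof (cases "b = []")
    case True
    have "c \<noteq> k" using snoc.prems by auto
    then have "{w \<in> insertions k [c] r. last w \<noteq> k} = {replicate r k @ [c]}"
      using insertions_snoc_other[of c k "[]" r] by (simp add: insertions_Nil)
    moreover have "des (replicate r k @ [c]) = 0" "maj (replicate r k @ [c]) = 0"
      "des [c] = 0" "maj [c] = 0"
      using snoc.prems des_replicate[of 1 c] maj_replicate[of 1 c]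
      by (auto simp: des_snoc maj_snoc des_replicate maj_replicate last_replicate split: if_splits)
    ultimately show ?thesis using True by (simp add: sum_ending_above_def box_sum_zero_parts)
  next
    case False
    have kb: "\<forall>a\<in>set b. k < a" "k < c" using snoc.prems by auto
    note upper = snoc.IH[OF False kb(1)]
    show ?thesis
    proof (cases "c < last b")
      case asc: False
      then have "sum_ending_above f k (b @ [c]) r = sum_ending_in f k b r + sum_ending_above f k b r"
        by (simp add: sum_ending_above_snoc[OF False kb(2)])
      also have "\<dots> = box_sum f (length b) (des b) (maj b) r"
        by (rule box_sum_in_above[OF False kb(1) upper])
      finally show ?thesis using asc by (simp add: des_snoc maj_snoc)
    next
      case True
      obtain n where n: "length b = Suc n" using False by (cases b) auto
      have stat: "des (b @ [c]) = Suc (des b)" "maj (b @ [c]) = maj b + length b"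
        using True False by (auto simp: des_snoc maj_snoc)
      have shift: "box_sum (\<lambda>s M. f (Suc s) (M + Suc n + r)) n (des b) (maj b) r =
        box_sum (\<lambda>s. f (Suc s)) n (des b) (maj b + Suc n + r) r"
        unfolding box_sum_def by (intro sum.cong) (auto simp: add_ac)
      have "sum_ending_above f k (b @ [c]) r = sum_ending_in f k b r +
          box_sum (\<lambda>s. f (Suc s)) n (des b) (maj b + Suc n + r) r"
        using True unfolding shift[symmetric] by (simp add: sum_ending_above_snoc[OF False kb(2)] upper n)
      also have "\<dots> = box_sum f (Suc n) (Suc (des b)) (maj b + Suc n) r"
      proof (cases r)
        case 0
        then show ?thesis by (simp add: sum_ending_in_0 False box_sum_no_parts)
      next
        case (Suc r')
        then show ?thesis
          using sum_ending_in_eq_if_above[OF False kb(1) upper]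
            box_sum_split_smallest[of f n "des b" "maj b + Suc n" r']
          by (simp add: n)
      qed
      finally show ?thesis by (simp add: stat n)
    qed
  qed
qed

lemma sum_insertions:
  assumes "\<forall>a\<in>set b. k < a"
  shows "(\<Sum>w\<in>insertions k b r. f (des w) (maj w)) = box_sum f (length b) (des b) (maj b) r"
proof (cases "b = []")
  case True
  then show ?thesis
    using des_replicate[of 0] maj_replicate[of 0]
    by (simp add: insertions_Nil des_replicate maj_replicate box_sum_zero_parts)
next
  case False
  then show ?thesis
    using insertions_sum_split[of "\<lambda>_. f"]
      box_sum_in_above[OF False assms sum_ending_above_eq[OF False assms]] by simp
qed

section \<open>Words with prescribed content\<close>

text \<open>
  The alphabet may start at any letter \<open>k\<close>, since removing the smallest letter shifts it.
\<close>

fun content_from :: "nat \<Rightarrow> nat list \<Rightarrow> nat multiset" where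
  "content_from k [] = {#}"
| "content_from k (r # \<rho>) = replicate_mset r k + content_from (Suc k) \<rho>"

lemma content_eq_content_from: "content \<rho> = content_from 1 \<rho>"
proof -
  have "(\<Sum>i<length \<rho>. replicate_mset (\<rho> ! i) (i + k)) = content_from k \<rho>" for k
  proof (induction \<rho> arbitrary: k)
    case (Cons r \<rho>)
    show ?case
      using Cons.IH[of "Suc k"] by (simp add: sum.lessThan_Suc_shift del: sum.lessThan_Suc)
  qed simp
  from this[of 1] show ?thesis
    by (simp add: content_def sum.atLeast1_atMost_eq)
qed

lemma content_from_ge: "a \<in># content_from k \<rho> \<Longrightarrow> k \<le> a"
  by (induction \<rho> arbitrary: k) (fastforce split: if_splits)+

lemma size_content_from: "size (content_from k \<rho>) = sum_list \<rho>"
  by (induction \<rho> arbitrary: k) auto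

text \<open>
  Arrangements of a multiset that contains \<open>k\<close> exactly \<open>r\<close> times, classified by the word that
  remains when \<open>k\<close> is deleted.
\<close>

lemma mset_eq_replicate_plus_iff:
  assumes "k \<notin># C"
  shows "mset w = replicate_mset r k + C \<longleftrightarrow>
    mset (filter (\<lambda>a. a \<noteq> k) w) = C \<and> count_list w k = r"
proof -
  have split: "mset w = replicate_mset (count_list w k) k + mset (filter (\<lambda>a. a \<noteq> k) w)"
    by (induction w) auto
  have "filter_mset (\<lambda>a. a \<noteq> k) C = C"
    using assms by (auto simp: filter_mset_eq_conv)
  moreover have "filter_mset (\<lambda>a. a \<noteq> k) (replicate_mset r k) = {#}"
    by (induction r) auto
  moreover have "count C k = 0" using assms by (simp add: not_in_iff)
  moreover have "count (mset w) k = count_list w k"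
    by (induction w) auto
  ultimately show ?thesis using split
    by (metis add_0 add.right_neutral count_replicate_mset count_union filter_union_mset mset_filter)
qed

text \<open>
  The codes of the permutations whose descents occur only at ends of blocks (see \<open>staircase_Des_cuts\<close>):
  each block is a partition whose parts are bounded by the number of letters to its right.
\<close>

fun block_codes :: "nat list \<Rightarrow> nat list set" where
  "block_codes [] = {[]}"
| "block_codes (r # \<rho>) = (\<lambda>(u, v). u @ v) ` (box (sum_list \<rho>) r \<times> block_codes \<rho>)"

text \<open>
  The induction hypothesis is applied to the function \<open>\<lambda>s M. box_sum f n s M r\<close>, the common
  contribution of the inserted letters \<open>k\<close> and of the block in front.
\<close>

lemma sum_des_maj_eq_sum_block_codes:
  "(\<Sum>w\<in>permutations_of_multiset (content_from k \<rho>). f (des w) (maj w)) =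
   (\<Sum>c\<in>block_codes \<rho>. f (foldr greedy_step c 0) (sum_list c))"
proof (induction \<rho> arbitrary: k f)
  case Nil
  show ?case using des_replicate[of 0] maj_replicate[of 0] by simp
next
  case (Cons r \<rho>)
  let ?C = "content_from (Suc k) \<rho>"
  let ?P = "permutations_of_multiset (content_from k (r # \<rho>))"
  have k: "k \<notin># ?C" using content_from_ge[of k "Suc k" \<rho>] by auto
  have mem: "w \<in> ?P \<longleftrightarrow> mset (filter (\<lambda>a. a \<noteq> k) w) = ?C \<and> count_list w k = r" for w
    using mset_eq_replicate_plus_iff[OF k, of w r] by (simp add: permutations_of_multiset_def)
  have "(\<Sum>w\<in>?P. f (des w) (maj w)) = (\<Sum>b\<in>permutations_of_multiset ?C.
      \<Sum>w\<in>{w \<in> ?P. filter (\<lambda>a. a \<noteq> k) w = b}. f (des w) (maj w))"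
    by (rule sum.group[symmetric])
      (auto simp: mem simp del: content_from.simps intro!: permutations_of_multisetI)
  also have "\<dots> = (\<Sum>b\<in>permutations_of_multiset ?C. box_sum f (sum_list \<rho>) (des b) (maj b) r)"
  proof (rule sum.cong[OF refl])
    fix b assume b: "b \<in> permutations_of_multiset ?C"
    then have mb: "mset b = ?C" by (simp add: permutations_of_multiset_def)
    then have "{w \<in> ?P. filter (\<lambda>a. a \<noteq> k) w = b} = insertions k b r"
      by (auto simp: mem insertions_def simp del: content_from.simps)
    moreover have "\<forall>a\<in>set b. k < a"
      using content_from_ge[of _ "Suc k" \<rho>] unfolding mb[symmetric] by fastforce
    moreover have "length b = sum_list \<rho>"
      using mb size_content_from[of "Suc k" \<rho>] size_mset[of b] by simp
    ultimately show "(\<Sum>w\<in>{w \<in> ?P. filter (\<lambda>a. a \<noteq> k) w = b}. f (des w) (maj w)) =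
        box_sum f (sum_list \<rho>) (des b) (maj b) r"
      using sum_insertions[of b k f r] by simp
  qed
  also have "\<dots> = (\<Sum>v\<in>block_codes \<rho>. box_sum f (sum_list \<rho>) (foldr greedy_step v 0) (sum_list v) r)"
    by (rule Cons.IH)
  also have "\<dots> = (\<Sum>u\<in>box (sum_list \<rho>) r. \<Sum>v\<in>block_codes \<rho>.
      f (foldr greedy_step (u @ v) 0) (sum_list (u @ v)))"
    unfolding box_sum_def by (subst sum.swap) (simp add: add.commute)
  also have "\<dots> = (\<Sum>c\<in>block_codes (r # \<rho>). f (foldr greedy_step c 0) (sum_list c))"
  proof -
    have "inj_on (\<lambda>(u, v). u @ v) (box (sum_list \<rho>) r \<times> block_codes \<rho>)"
      by (auto simp: inj_on_def box_def)
    then show ?thesis by (simp add: sum.reindex sum.cartesian_product case_prod_unfold)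
  qed
  finally show ?case .
qed

section \<open>Words below a staircase with prescribed descents\<close>

definition staircase :: "nat \<Rightarrow> nat list set" where
  "staircase n = {c. length c = n \<and> (\<forall>i<n. c ! i < n - i)}"

text \<open>
  The ends of all blocks, including the last one. The last one is never a descent, and including it
  makes the recursion uniform.
\<close>

fun cuts :: "nat list \<Rightarrow> nat set" where
  "cuts [] = {}"
| "cuts (r # \<rho>) = insert r ((+) r ` cuts \<rho>)"

lemma cuts_eq_partial_sums: "cuts \<rho> = (\<lambda>i. sum_list (take i \<rho>)) ` {1..length \<rho>}"
proof (induction \<rho>)
  case (Cons r \<rho>)
  have "{1..length (r # \<rho>)} = insert 1 (Suc ` {1..length \<rho>})"
    by (auto simp: image_iff Bex_def)
  then show ?case by (simp add: Cons.IH image_image image_Un del: image_Suc_atLeastAtMost)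
qed simp

lemma Des_subset_iff: "Des w \<subseteq> R \<longleftrightarrow> (\<forall>i. Suc i < length w \<longrightarrow> w ! Suc i < w ! i \<longrightarrow> Suc i \<in> R)"
proof
  assume *: "\<forall>i. Suc i < length w \<longrightarrow> w ! Suc i < w ! i \<longrightarrow> Suc i \<in> R"
  show "Des w \<subseteq> R"
  proof
    fix i assume "i \<in> Des w"
    then show "i \<in> R" using *[rule_format, of "i - 1"] by (auto simp: Des_def)
  qed
next
  assume "Des w \<subseteq> R"
  then show "\<forall>i. Suc i < length w \<longrightarrow> w ! Suc i < w ! i \<longrightarrow> Suc i \<in> R"
    by (fastforce simp: Des_def)
qed

text \<open>
  A descent at the border between \<open>u\<close> and \<open>v\<close> is allowed, so the conditions on \<open>u\<close> and \<open>v\<close>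
  are independent.
\<close>

lemma Des_append_subset_iff:
  "Des (u @ v) \<subseteq> insert (length u) ((+) (length u) ` R) \<longleftrightarrow> sorted u \<and> Des v \<subseteq> R"
proof (intro iffI conjI)
  assume *: "Des (u @ v) \<subseteq> insert (length u) ((+) (length u) ` R)"
  show "sorted u"
    unfolding sorted_iff_nth_Suc
  proof (intro allI impI)
    fix i assume i: "Suc i < length u"
    have "Suc i \<notin> insert (length u) ((+) (length u) ` R)" using i by auto
    then have "\<not> (u @ v) ! Suc i < (u @ v) ! i"
      using *[unfolded Des_subset_iff, rule_format, of i] i by auto
    then show "u ! i \<le> u ! Suc i" using i by (simp add: nth_append)
  qed
  show "Des v \<subseteq> R"
    unfolding Des_subset_iff
  proof (intro allI impI)
    fix i assume i: "Suc i < length v" "v ! Suc i < v ! i"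
    then have "Suc (length u + i) \<in> insert (length u) ((+) (length u) ` R)"
      using *[unfolded Des_subset_iff, rule_format, of "length u + i"]
      by (simp add: nth_append)
    then show "Suc i \<in> R" by auto
  qed
next
  assume *: "sorted u \<and> Des v \<subseteq> R"
  show "Des (u @ v) \<subseteq> insert (length u) ((+) (length u) ` R)"
    unfolding Des_subset_iff
  proof (intro allI impI)
    fix i assume i: "Suc i < length (u @ v)" "(u @ v) ! Suc i < (u @ v) ! i"
    consider "Suc i < length u" | "Suc i = length u" | "length u \<le> i" by linarith
    then show "Suc i \<in> insert (length u) ((+) (length u) ` R)"
    proof cases
      case 1
      then show ?thesis using * i sorted_nth_mono[of u i "Suc i"] by (simp add: nth_append)
    next
      case 3
      then have "Suc (i - length u) \<in> R"
        using * i by (auto simp: Des_subset_iff nth_append Suc_diff_le)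
      then have "length u + Suc (i - length u) \<in> (+) (length u) ` R" by (rule imageI)
      then show ?thesis using 3 by simp
    qed simp
  qed
qed

text \<open>
  The bounds on \<open>u\<close> decrease to \<open>n\<close>, which is the bound on its last letter. As \<open>u\<close> is weakly
  increasing, this last bound implies the others.
\<close>

lemma append_mem_staircase_iff:
  assumes "sorted u"
  shows "u @ v \<in> staircase (length u + n) \<longleftrightarrow> set u \<subseteq> {..n} \<and> v \<in> staircase n"
proof (intro iffI conjI)
  assume "u @ v \<in> staircase (length u + n)"
  then have len: "length v = n"
    and bound: "\<And>i. i < length u + n \<Longrightarrow> (u @ v) ! i < length u + n - i"
    by (auto simp: staircase_def)
  have "v ! i < n - i" if "i < n" for i
    using bound[of "length u + i"] that by (simp add: nth_append)
  then show "v \<in> staircase n" using len by (simp add: staircase_def)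
  show "set u \<subseteq> {..n}"
  proof
    fix a assume "a \<in> set u"
    then obtain i where i: "i < length u" "a = u ! i" by (auto simp: in_set_conv_nth)
    then have "a \<le> u ! (length u - 1)" using sorted_nth_mono[OF assms, of i "length u - 1"] by simp
    also have "\<dots> \<le> n" using bound[of "length u - 1"] i
      by (cases u) (auto simp: nth_append simp flip: append_Cons)
    finally show "a \<in> {..n}" by simp
  qed
next
  assume *: "set u \<subseteq> {..n} \<and> v \<in> staircase n"
  have "(u @ v) ! i < length u + n - i" if "i < length u + n" for i
  proof (cases "i < length u")
    case True
    then have "u ! i \<le> n" using * nth_mem by blast
    then show ?thesis using True by (simp add: nth_append)
  next
    case False
    then have "i - length u < n" using that by linarith
    then have "v ! (i - length u) < n - (i - length u)"
      using * unfolding staircase_def by blast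
    then show ?thesis using False by (simp add: nth_append)
  qed
  then show "u @ v \<in> staircase (length u + n)" using * by (simp add: staircase_def)
qed

lemma staircase_Des_cuts:
  "{c \<in> staircase (sum_list \<rho>). Des c \<subseteq> cuts \<rho>} = block_codes \<rho>"
proof (induction \<rho>)
  case Nil
  show ?case by (auto simp: staircase_def Des_def)
next
  case (Cons r \<rho>)
  have iff: "u @ v \<in> {c \<in> staircase (sum_list (r # \<rho>)). Des c \<subseteq> cuts (r # \<rho>)} \<longleftrightarrow>
      u \<in> box (sum_list \<rho>) r \<and> v \<in> block_codes \<rho>" if "length u = r" for u v
    using that Des_append_subset_iff[of u v "cuts \<rho>"]
      append_mem_staircase_iff[of u v "sum_list \<rho>"]
    unfolding Cons.IH[symmetric] by (auto simp: box_def)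
  show ?case
  proof (intro set_eqI iffI)
    fix c assume c: "c \<in> {c \<in> staircase (sum_list (r # \<rho>)). Des c \<subseteq> cuts (r # \<rho>)}"
    then have "length (take r c) = r" by (auto simp: staircase_def)
    then have "take r c \<in> box (sum_list \<rho>) r \<and> drop r c \<in> block_codes \<rho>"
      using iff[of "take r c" "drop r c"] c by simp
    then have "(\<lambda>(u, v). u @ v) (take r c, drop r c) \<in> block_codes (r # \<rho>)"
      unfolding block_codes.simps by (intro imageI) simp
    then show "c \<in> block_codes (r # \<rho>)" by simp
  next
    fix c assume "c \<in> block_codes (r # \<rho>)"
    then obtain u v where "c = u @ v" "u \<in> box (sum_list \<rho>) r" "v \<in> block_codes \<rho>" by auto
    then show "c \<in> {c \<in> staircase (sum_list (r # \<rho>)). Des c \<subseteq> cuts (r # \<rho>)}"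
      using iff[of u v] by (simp add: box_def)
  qed
qed

section \<open>The code as a bijection\<close>

text \<open>
  The code of a permutation, computed for an arbitrary list, so that the first letter can be removed
  although the rest is no longer a permutation of an initial segment.
\<close>

fun lehmer :: "nat list \<Rightarrow> nat list" where
  "lehmer [] = []"
| "lehmer (x # xs) = card {y \<in> set xs. y < x} # lehmer xs"

lemma length_lehmer: "length (lehmer xs) = length xs"
  by (induction xs) auto

lemma lehmer_nth: "i < length xs \<Longrightarrow> lehmer xs ! i = card {y \<in> set (drop (Suc i) xs). y < xs ! i}"
  by (induction xs arbitrary: i) (auto simp: nth_Cons split: nat.split)

text \<open>
  Let \<open>x\<close>, \<open>y\<close> be adjacent letters and \<open>S\<close> the set of the letters after them. If \<open>x > y\<close>, then
  the letters counted for \<open>x\<close> are those counted for \<open>y\<close>, some more of \<open>S\<close> perhaps, and \<open>y\<close> itself;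
  if \<open>x < y\<close>, they are among those counted for \<open>y\<close>.
\<close>

lemma Des_lehmer:
  assumes "distinct xs"
  shows "Des (lehmer xs) = Des xs"
proof -
  have "lehmer xs ! i < lehmer xs ! (i - 1) \<longleftrightarrow> xs ! i < xs ! (i - 1)"
    if i: "i \<in> {1..length xs - 1}" for i
  proof -
    let ?S = "set (drop (Suc i) xs)"
    have lt: "i < length xs" "i - 1 < length xs" "Suc (i - 1) = i" using i by auto
    have ins: "set (drop i xs) = insert (xs ! i) ?S"
      using Cons_nth_drop_Suc[OF lt(1)] by (metis list.simps(15))
    have notin: "xs ! i \<notin> ?S"
      using Cons_nth_drop_Suc[OF lt(1)] assms distinct_drop[of xs i] by (metis distinct.simps(2))
    have neq: "xs ! i \<noteq> xs ! (i - 1)"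
      using nth_eq_iff_index_eq[OF assms lt(1,2)] lt(3) by (metis n_not_Suc_n)
    have left: "lehmer xs ! (i - 1) = card {y \<in> insert (xs ! i) ?S. y < xs ! (i - 1)}"
      using lehmer_nth[OF lt(2)] by (simp only: lt(3) ins)
    have right: "lehmer xs ! i = card {y \<in> ?S. y < xs ! i}" using lehmer_nth[OF lt(1)] .
    show ?thesis
    proof (cases "xs ! i < xs ! (i - 1)")
      case True
      have "Suc (card {y \<in> ?S. y < xs ! i}) = card (insert (xs ! i) {y \<in> ?S. y < xs ! i})"
        using notin by simp
      also have "\<dots> \<le> card {y \<in> insert (xs ! i) ?S. y < xs ! (i - 1)}"
        using True by (intro card_mono) auto
      finally show ?thesis using True left right by simp
    next
      case False
      have "card {y \<in> insert (xs ! i) ?S. y < xs ! (i - 1)} \<le> card {y \<in> ?S. y < xs ! i}"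
        using False neq by (intro card_mono) auto
      then show ?thesis using False left right by simp
    qed
  qed
  then show ?thesis by (auto simp: Des_def length_lehmer)
qed

lemma staircase_0: "staircase 0 = {[]}"
  by (auto simp: staircase_def)

lemma Cons_mem_staircase_iff: "k # c \<in> staircase (Suc n) \<longleftrightarrow> k \<le> n \<and> c \<in> staircase n"
  unfolding staircase_def mem_Collect_eq All_less_Suc2 by (auto simp: less_Suc_eq_le)

lemma Cons_mem_permutations_of_set_iff:
  "x # xs \<in> permutations_of_set A \<longleftrightarrow> x \<in> A \<and> xs \<in> permutations_of_set (A - {x})"
  by (auto simp: permutations_of_set_def)

lemma bij_betw_rank:
  fixes A :: "nat set"
  assumes "finite A"
  shows "bij_betw (\<lambda>x. card {y \<in> A. y < x}) A {..<card A}"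
proof -
  have less: "card {y \<in> A. y < x} < card {y \<in> A. y < z}" if "x \<in> A" "x < z" for x z
    using that assms by (intro psubset_card_mono) auto
  have inj: "inj_on (\<lambda>x. card {y \<in> A. y < x}) A"
  proof (rule inj_onI)
    fix x z assume "x \<in> A" "z \<in> A" "card {y \<in> A. y < x} = card {y \<in> A. y < z}"
    then show "x = z" using less[of x z] less[of z x] by (cases x z rule: linorder_cases) auto
  qed
  have "(\<lambda>x. card {y \<in> A. y < x}) ` A \<subseteq> {..<card A}"
    using assms by (auto intro!: psubset_card_mono)
  then have "(\<lambda>x. card {y \<in> A. y < x}) ` A = {..<card A}"
    by (intro card_subset_eq) (simp_all add: card_image[OF inj])
  with inj show ?thesis by (simp add: bij_betw_def)
qed

text \<open>
  The first entry of the code is the rank of the first letter in \<open>A\<close> and so determines it; then the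
  remaining word is recovered by induction.
\<close>

lemma bij_betw_lehmer:
  "finite A \<Longrightarrow> bij_betw lehmer (permutations_of_set A) (staircase (card A))"
proof (induction "card A" arbitrary: A)
  case 0
  then show ?case by (simp add: staircase_0 bij_betw_def)
next
  case (Suc n)
  let ?rank = "\<lambda>x. card {y \<in> A. y < x}"
  have nonempty: "xs \<noteq> []" if "xs \<in> permutations_of_set A" for xs
    using that Suc.hyps(2) by (auto simp: permutations_of_set_def)
  have IH: "bij_betw lehmer (permutations_of_set (A - {x})) (staircase n)" if "x \<in> A" for x
  proof -
    have n: "n = card (A - {x})" using Suc.hyps(2) Suc.prems that by simp
    then show ?thesis using Suc.hyps(1)[OF n] Suc.prems by (metis finite_Diff)
  qed
  have rank: "bij_betw ?rank A {..n}"
    using bij_betw_rank[OF Suc.prems] unfolding Suc.hyps(2)[symmetric] lessThan_Suc_atMost .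
  have lehmer: "lehmer (x # xs) = ?rank x # lehmer xs" if "x # xs \<in> permutations_of_set A" for x xs
    using that by (auto simp: permutations_of_set_def intro!: arg_cong[of _ _ card])
  show ?case
    unfolding Suc.hyps(2)[symmetric] bij_betw_def
  proof (intro conjI inj_onI set_eqI iffI)
    fix u v assume u: "u \<in> permutations_of_set A" and v: "v \<in> permutations_of_set A"
      and eq: "lehmer u = lehmer v"
    obtain x xs y ys where uv: "u = x # xs" "v = y # ys"
      using nonempty[OF u] nonempty[OF v] by (meson list.exhaust)
    note u = u[unfolded uv] and v = v[unfolded uv]
    have *: "?rank x = ?rank y" "lehmer xs = lehmer ys"
      using eq lehmer[OF u] lehmer[OF v] uv by simp_all
    have "x = y"
      using rank *(1) u v by (auto simp: bij_betw_def Cons_mem_permutations_of_set_iff dest: inj_onD)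
    moreover have "xs = ys"
      using IH[of x] *(2) u v \<open>x = y\<close>
      by (auto simp: bij_betw_def Cons_mem_permutations_of_set_iff dest: inj_onD)
    ultimately show "u = v" using uv by simp
  next
    fix c assume "c \<in> lehmer ` permutations_of_set A"
    then obtain u where u: "u \<in> permutations_of_set A" "c = lehmer u" by blast
    obtain x xs where x: "u = x # xs" using nonempty[OF u(1)] by (cases u) auto
    note u = u[unfolded x]
    have "x \<in> A" "xs \<in> permutations_of_set (A - {x})"
      using u(1) by (simp_all add: Cons_mem_permutations_of_set_iff)
    then show "c \<in> staircase (Suc n)"
      using bij_betwE[OF rank] bij_betwE[OF IH[of x]] lehmer[OF u(1)] u(2)
      by (simp add: Cons_mem_staircase_iff)
  next
    fix c assume "c \<in> staircase (Suc n)"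
    moreover then obtain k c' where c: "c = k # c'" by (cases c) (auto simp: staircase_def)
    ultimately have kc: "k \<in> {..n}" "c' \<in> staircase n" by (simp_all add: Cons_mem_staircase_iff)
    obtain x where x: "x \<in> A" "?rank x = k"
      using rank kc(1) unfolding bij_betw_def by (metis (no_types, lifting) imageE)
    obtain xs where xs: "xs \<in> permutations_of_set (A - {x})" "lehmer xs = c'"
      using IH[OF x(1)] kc(2) by (metis bij_betw_imp_surj_on imageE)
    have mem: "x # xs \<in> permutations_of_set A"
      using x xs by (simp add: Cons_mem_permutations_of_set_iff)
    have "lehmer (x # xs) = c" unfolding lehmer[OF mem] x(2) xs(2) c ..
    then show "c \<in> lehmer ` permutations_of_set A" by (rule image_eqI[OF sym mem])
  qed
qed

lemma code_eq_lehmer: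
  assumes "inj \<sigma>"
  shows "code n \<sigma> = lehmer (one_line n \<sigma>)"
proof -
  have "lehmer (map \<sigma> [k..<Suc n]) =
      map (\<lambda>i. card {j. i < j \<and> j \<le> n \<and> \<sigma> i > \<sigma> j}) [k..<Suc n]" if "k \<le> Suc n" for k
    using that
  proof (induction k rule: inc_induct)
    case (step k)
    have "{y \<in> \<sigma> ` {Suc k..<Suc n}. y < \<sigma> k} = \<sigma> ` {j. k < j \<and> j \<le> n \<and> \<sigma> k > \<sigma> j}"
      by auto
    then have "card {y \<in> \<sigma> ` {Suc k..<Suc n}. y < \<sigma> k} = card {j. k < j \<and> j \<le> n \<and> \<sigma> k > \<sigma> j}"
      using assms by (simp add: card_image inj_on_subset)
    then show ?case
      using step by (simp add: upt_conv_Cons del: upt_Suc)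
  qed simp
  from this[of 1] show ?thesis by (simp add: code_def one_line_def)
qed

lemma bij_betw_one_line:
  "bij_betw (one_line n) {\<sigma>. \<sigma> permutes {1..n}} (permutations_of_set {1..n})"
proof -
  have inj: "inj_on (one_line n) {\<sigma>. \<sigma> permutes {1..n}}"
  proof (rule inj_onI, rule ext)
    fix \<sigma> \<tau> i
    assume *: "\<sigma> \<in> {\<sigma>. \<sigma> permutes {1..n}}" "\<tau> \<in> {\<sigma>. \<sigma> permutes {1..n}}"
      "one_line n \<sigma> = one_line n \<tau>"
    show "\<sigma> i = \<tau> i"
      using * by (cases "i \<in> {1..n}") (auto simp: one_line_def permutes_not_in simp del: upt_Suc)
  qed
  have "one_line n ` {\<sigma>. \<sigma> permutes {1..n}} \<subseteq> permutations_of_set {1..n}"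
  proof
    fix w assume "w \<in> one_line n ` {\<sigma>. \<sigma> permutes {1..n}}"
    then obtain \<sigma> where \<sigma>: "\<sigma> permutes {1..n}" "w = one_line n \<sigma>" by blast
    have "{1..<Suc n} = {1..n}" by auto
    then have "set w = {1..n}"
      using \<sigma> permutes_image[OF \<sigma>(1)] by (simp add: one_line_def del: upt_Suc)
    moreover have "distinct w"
      using \<sigma> by (simp add: one_line_def distinct_map permutes_inj_on del: upt_Suc)
    ultimately show "w \<in> permutations_of_set {1..n}" by (auto simp: permutations_of_set_def)
  qed
  moreover have "card (one_line n ` {\<sigma>. \<sigma> permutes {1..n}}) = card (permutations_of_set {1..n})"
  proof -
    have "card {\<sigma>. \<sigma> permutes {1..n}} = fact n" by (rule card_permutations) auto
    then show ?thesis using card_image[OF inj] by simp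
  qed
  ultimately show ?thesis
    using inj card_subset_eq[of "permutations_of_set {1..n}"] by (simp add: bij_betw_def)
qed

section \<open>Length and inversions\<close>

definition inversions :: "nat \<Rightarrow> (nat \<Rightarrow> nat) \<Rightarrow> (nat \<times> nat) set" where
  "inversions n \<sigma> = {(i, j). i \<in> {1..n} \<and> i < j \<and> j \<le> n \<and> \<sigma> j < \<sigma> i}"

lemma finite_inversions: "finite (inversions n \<sigma>)"
  by (rule finite_subset[of _ "{1..n} \<times> {1..n}"]) (auto simp: inversions_def)

lemma card_inversions_eq_sum_code: "card (inversions n \<sigma>) = sum_list (code n \<sigma>)"
proof -
  have "inversions n \<sigma> = (SIGMA i:{1..n}. {j. i < j \<and> j \<le> n \<and> \<sigma> i > \<sigma> j})"
    by (auto simp: inversions_def)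
  moreover have "{1..<Suc n} = {1..n}" by auto
  ultimately show ?thesis
    by (simp add: code_def sum_list_distinct_conv_sum_set del: upt_Suc)
qed

text \<open>
  Exchanging the adjacent values \<open>a\<close> and \<open>Suc a\<close> changes the relative order of no other pair of
  values, so one inversion is gained.
\<close>

lemma card_inversions_ascent:
  assumes "inj \<sigma>" "i \<in> {1..n}" "i < j" "j \<le> n" "\<sigma> i = a" "\<sigma> j = Suc a"
  shows "card (inversions n (transpose a (Suc a) \<circ> \<sigma>)) = Suc (card (inversions n \<sigma>))"
proof -
  have eqi: "\<sigma> x = a \<longleftrightarrow> x = i" for x
    by (simp only: assms(5)[symmetric] inj_eq[OF assms(1)])
  have eqj: "\<sigma> x = Suc a \<longleftrightarrow> x = j" for x
    by (simp only: assms(6)[symmetric] inj_eq[OF assms(1)])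
  have order: "transpose a (Suc a) (\<sigma> y) < transpose a (Suc a) (\<sigma> x) \<longleftrightarrow>
      \<sigma> y < \<sigma> x \<or> x = i \<and> y = j" if "x < y" for x y
    using that assms(3) eqi[of x] eqi[of y] eqj[of x] eqj[of y]
    by (auto simp: transpose_def split: if_splits)
  have "inversions n (transpose a (Suc a) \<circ> \<sigma>) = insert (i, j) (inversions n \<sigma>)"
    using assms order by (auto simp: inversions_def)
  moreover have "(i, j) \<notin> inversions n \<sigma>" using assms by (simp add: inversions_def)
  ultimately show ?thesis by (simp add: finite_inversions)
qed

lemma card_inversions_descent:
  assumes "inj \<sigma>" "i \<in> {1..n}" "i < j" "j \<le> n" "\<sigma> i = Suc a" "\<sigma> j = a"
  shows "Suc (card (inversions n (transpose a (Suc a) \<circ> \<sigma>))) = card (inversions n \<sigma>)"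
proof -
  let ?\<tau> = "transpose a (Suc a) \<circ> \<sigma>"
  have "inj ?\<tau>" using assms(1) by (simp add: inj_compose)
  moreover have "transpose a (Suc a) \<circ> ?\<tau> = \<sigma>" by (simp flip: comp_assoc)
  ultimately show ?thesis using card_inversions_ascent[of ?\<tau> i n j a] assms by simp
qed

lemma adjacent_transpose_permutes: "a \<in> {1..<n} \<Longrightarrow> transpose a (Suc a) permutes {1..n}"
  by (rule permutes_swap_id) auto

lemma card_inversions_transpose_le:
  assumes "\<sigma> permutes {1..n}" "a \<in> {1..<n}"
  shows "card (inversions n (transpose a (Suc a) \<circ> \<sigma>)) \<le> Suc (card (inversions n \<sigma>))"
proof -
  have inj: "inj \<sigma>" using assms(1) by (rule permutes_inj)
  obtain i j where ij: "i \<in> {1..n}" "j \<in> {1..n}" "\<sigma> i = a" "\<sigma> j = Suc a"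
    using assms permutes_image[OF assms(1)]
    by (metis (no_types, lifting) Suc_leI atLeastAtMost_iff atLeastLessThan_iff imageE le_SucI less_imp_le)
  then have "i \<noteq> j" by auto
  then consider "i < j" | "j < i" by linarith
  then show ?thesis
  proof cases
    case 1
    then show ?thesis using card_inversions_ascent[OF inj, of i n j a] ij by simp
  next
    case 2
    then show ?thesis using card_inversions_descent[OF inj, of j n i a] ij by simp
  qed
qed

lemma inversions_id: "inversions n id = {}"
  by (auto simp: inversions_def)

definition word_perm :: "nat list \<Rightarrow> nat \<Rightarrow> nat" where
  "word_perm is = foldr (\<lambda>i \<tau>. transpose i (Suc i) \<circ> \<tau>) is id"

lemma word_perm_Nil: "word_perm [] = id"
  and word_perm_Cons: "word_perm (a # is) = transpose a (Suc a) \<circ> word_perm is"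
  by (simp_all only: word_perm_def foldr_Nil foldr_Cons comp_apply id_apply)

lemma word_perm_permutes: "set is \<subseteq> {1..<n} \<Longrightarrow> word_perm is permutes {1..n}"
  by (induction "is")
    (simp_all add: word_perm_Nil word_perm_Cons permutes_id permutes_compose
      adjacent_transpose_permutes del: One_nat_def)

lemma card_inversions_word_perm_le:
  "set is \<subseteq> {1..<n} \<Longrightarrow> card (inversions n (word_perm is)) \<le> length is"
proof (induction "is")
  case Nil
  show ?case by (simp only: word_perm_Nil inversions_id card.empty le0)
next
  case (Cons a "is")
  have "card (inversions n (word_perm is)) \<le> length is" using Cons by simp
  moreover have "card (inversions n (transpose a (Suc a) \<circ> word_perm is)) \<le>
      Suc (card (inversions n (word_perm is)))"
    using Cons.prems by (intro card_inversions_transpose_le word_perm_permutes) simp_all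
  ultimately show ?case unfolding word_perm_Cons list.size by linarith
qed

text \<open>
  Strict growth at each step forces \<open>a \<le> \<tau> a\<close> everywhere, and only the identity has this property.
\<close>

lemma permutes_increasing_eq_id:
  fixes \<tau> :: "nat \<Rightarrow> nat"
  assumes "\<tau> permutes {1..n}" "\<forall>a\<in>{1..<n}. \<tau> a < \<tau> (Suc a)"
  shows "\<tau> = id"
proof -
  have "a \<le> \<tau> a" if "1 \<le> a" "a \<le> n" for a
    using that
  proof (induction a rule: nat_induct_at_least)
    case base
    then show ?case using permutes_in_image[OF assms(1), of 1] by auto
  next
    case (Suc a)
    then have "\<tau> a < \<tau> (Suc a)" using assms(2) by simp
    then show ?case using Suc by simp
  qed
  then show ?thesis by (intro permutes_natset_ge[OF assms(1)]) simp
qed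

text \<open>
  A permutation other than the identity has adjacent values \<open>a\<close>, \<open>Suc a\<close> in the wrong order, that is,
  a descent of its inverse. Exchanging them removes one inversion.
\<close>

lemma exists_word_of_length_inversions:
  assumes "\<sigma> permutes {1..n}"
  shows "\<exists>is. length is = card (inversions n \<sigma>) \<and> set is \<subseteq> {1..<n} \<and>
    \<sigma> = word_perm is"
  using assms
proof (induction "card (inversions n \<sigma>)" arbitrary: \<sigma> rule: less_induct)
  case less
  have inv: "inv \<sigma> permutes {1..n}" using less.prems by (rule permutes_inv)
  show ?case
  proof (cases "\<forall>a\<in>{1..<n}. inv \<sigma> a < inv \<sigma> (Suc a)")
    case True
    have "inv (inv \<sigma>) = inv id" using permutes_increasing_eq_id[OF inv True] by simp
    then have "\<sigma> = id" using permutes_inv_inv[OF less.prems] by simp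
    then show ?thesis by (intro exI[of _ "[]"]) (simp add: inversions_id word_perm_Nil)
  next
    case False
    then obtain a where a: "a \<in> {1..<n}" "\<not> inv \<sigma> a < inv \<sigma> (Suc a)" by blast
    have val: "\<sigma> (inv \<sigma> x) = x" for x using permutes_inverses(1)[OF less.prems] .
    have neq: "inv \<sigma> a \<noteq> inv \<sigma> (Suc a)" using val by (metis n_not_Suc_n)
    have "inv \<sigma> a \<in> {1..n}" "inv \<sigma> (Suc a) \<in> {1..n}"
      using a(1) by (simp_all only: permutes_in_image[OF inv]) auto
    then have desc: "Suc (card (inversions n (transpose a (Suc a) \<circ> \<sigma>))) = card (inversions n \<sigma>)"
      using a neq by (intro card_inversions_descent[OF permutes_inj[OF less.prems],
            of "inv \<sigma> (Suc a)" n "inv \<sigma> a"]) (auto simp: val)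
    have "transpose a (Suc a) \<circ> \<sigma> permutes {1..n}"
      using less.prems adjacent_transpose_permutes[OF a(1)] by (rule permutes_compose)
    then obtain "is" where "is": "length is = card (inversions n (transpose a (Suc a) \<circ> \<sigma>))"
      "set is \<subseteq> {1..<n}"
      "transpose a (Suc a) \<circ> \<sigma> = word_perm is"
      using less.hyps[of "transpose a (Suc a) \<circ> \<sigma>"] desc by auto
    have "\<sigma> = transpose a (Suc a) \<circ> (transpose a (Suc a) \<circ> \<sigma>)" by (simp flip: comp_assoc)
    also have "\<dots> = word_perm (a # is)" by (simp only: "is"(3) word_perm_Cons)
    finally show ?thesis
      using "is" desc a(1) by (intro exI[of _ "a # is"]) simp
  qed
qed

text \<open>
  Each letter of a word in the simple transpositions changes the number of inversions by one, so no word
  is shorter than this number, and it is attained by sorting.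
\<close>

lemma coxeter_length_eq_sum_code:
  assumes "\<sigma> permutes {1..n}"
  shows "coxeter_length n \<sigma> = sum_list (code n \<sigma>)"
  unfolding coxeter_length_def card_inversions_eq_sum_code[symmetric] word_perm_def[symmetric]
proof (rule Least_equality)
  show "\<exists>is. length is = card (inversions n \<sigma>) \<and> set is \<subseteq> {1..<n} \<and> \<sigma> = word_perm is"
    by (rule exists_word_of_length_inversions[OF assms])
  show "card (inversions n \<sigma>) \<le> k"
    if "\<exists>is. length is = k \<and> set is \<subseteq> {1..<n} \<and> \<sigma> = word_perm is" for k
    using that card_inversions_word_perm_le by blast
qed

section \<open>Equidistribution\<close>

theorem proposition2p3:
  fixes N m :: nat and \<rho> :: "nat list" and r :: "nat \<Rightarrow> nat" and R :: "nat set"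
  assumes "composition N \<rho>"
    and "m = length \<rho>"
    and "\<And>i. i \<in> {1..m - 1} \<Longrightarrow> r i = (\<Sum>k\<in>{1..i}. \<rho> ! (k - 1))"
    and "R = r ` {1..m - 1}"
  shows "(\<Sum>w\<in>multiperms \<rho>. var_x ^ des w * var_q ^ maj w) =
         (\<Sum>\<sigma>\<in>perms_Des_in N R. var_x ^ stc N \<sigma> * var_q ^ coxeter_length N \<sigma>)"
proof -
  let ?f = "\<lambda>s M. var_x ^ s * var_q ^ M"
  let ?S = "{\<sigma>. \<sigma> permutes {1..N}}"
  have N: "sum_list \<rho> = N" using assms(1) by (simp add: composition_def)
  have r: "r i = sum_list (take i \<rho>)" if "i \<in> {1..m - 1}" for i
  proof -
    have "i \<le> length \<rho>" using that assms(2) by auto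
    then have "sum_list (take i \<rho>) = (\<Sum>k<i. \<rho> ! k)"
      by (simp add: sum_list_sum_nth min.absorb2 lessThan_atLeast0)
    then show ?thesis using assms(3)[OF that] by (simp add: sum.atLeast1_atMost_eq)
  qed
  have R: "R = (\<lambda>i. sum_list (take i \<rho>)) ` {1..m - 1}"
    unfolding assms(4) using r by (rule image_cong[OF refl])
  \<comment> \<open>The two sets differ at most in \<open>N\<close>, the end of the last block, which is no descent.\<close>
  have cuts: "Des w \<subseteq> R \<longleftrightarrow> Des w \<subseteq> cuts \<rho>" if "length w = N" for w
  proof -
    have "N \<notin> Des w" using that by (auto simp: Des_def)
    moreover have "cuts \<rho> - {N} \<subseteq> R"
    proof
      fix x assume "x \<in> cuts \<rho> - {N}"
      then obtain i where i: "i \<in> {1..m}" "x = sum_list (take i \<rho>)" "x \<noteq> N"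
        unfolding cuts_eq_partial_sums assms(2) by blast
      then have "i \<noteq> m" using N assms(2) by auto
      then show "x \<in> R" unfolding R using i by (intro image_eqI[of _ _ i]) auto
    qed
    moreover have "R \<subseteq> cuts \<rho>"
      unfolding R cuts_eq_partial_sums assms(2) by (intro image_mono) auto
    ultimately show ?thesis by blast
  qed
  have code: "code N \<sigma> = lehmer (one_line N \<sigma>)" if "\<sigma> \<in> ?S" for \<sigma>
    using that by (intro code_eq_lehmer permutes_inj[of _ "{1..N}"]) simp
  have "bij_betw (lehmer \<circ> one_line N) ?S (staircase N)"
    using bij_betw_trans[OF bij_betw_one_line bij_betw_lehmer[of "{1..N}"]] by simp
  then have bij: "bij_betw (code N) ?S (staircase N)"
    using code by (subst bij_betw_cong[of _ _ "lehmer \<circ> one_line N"]) simp_all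
  have Des: "Des (one_line N \<sigma>) \<subseteq> R \<longleftrightarrow> Des (code N \<sigma>) \<subseteq> cuts \<rho>" if "\<sigma> \<in> ?S" for \<sigma>
  proof -
    have "distinct (one_line N \<sigma>)"
      using bij_betwE[OF bij_betw_one_line] that by (auto simp: permutations_of_set_def)
    then show ?thesis
      using cuts[of "code N \<sigma>"] Des_lehmer code[OF that] by (simp add: code_def)
  qed
  have perms: "perms_Des_in N R = {\<sigma> \<in> ?S. code N \<sigma> \<in> {c \<in> staircase N. Des c \<subseteq> cuts \<rho>}}"
    using Des bij_betwE[OF bij] unfolding perms_Des_in_def by blast
  have bij': "bij_betw (code N) (perms_Des_in N R) (block_codes \<rho>)"
  proof -
    have blocks: "block_codes \<rho> = {c \<in> staircase N. Des c \<subseteq> cuts \<rho>}"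
      using staircase_Des_cuts[of \<rho>] N by simp
    show ?thesis
      using bij unfolding perms blocks bij_betw_def by (auto intro: inj_on_subset)
  qed
  have "(\<Sum>w\<in>multiperms \<rho>. ?f (des w) (maj w)) =
      (\<Sum>c\<in>block_codes \<rho>. ?f (foldr greedy_step c 0) (sum_list c))"
    unfolding multiperms_def content_eq_content_from by (rule sum_des_maj_eq_sum_block_codes)
  also have "\<dots> = (\<Sum>\<sigma>\<in>perms_Des_in N R. ?f (foldr greedy_step (code N \<sigma>) 0) (sum_list (code N \<sigma>)))"
    by (rule sum.reindex_bij_betw[OF bij', symmetric])
  also have "\<dots> = (\<Sum>\<sigma>\<in>perms_Des_in N R. ?f (stc N \<sigma>) (coxeter_length N \<sigma>))"
    by (intro sum.cong refl)
      (simp add: stc_def st_eq_foldr_greedy_step coxeter_length_eq_sum_code perms_Des_in_def)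
  finally show ?thesis .
qed

end
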